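(* Consider the curved 3-body problem with one negligible mass: $m_1=M>0$, $m_2=m>0$, $m_3=0$. (i) If $\kappa<0$, there are no Lagrangian relative equilibria in $\mathbb H_\kappa^2$. (ii) If the curvature $\kappa>0$ is sufficiently small (i.e. for all $\kappa\in(0,\kappa_0)$ for some $\kappa_0>0$, the masses being given), there are no Lagrangian relative equilibria in $\mathbb S_\kappa^2$, unless the two non-negligible masses are equal, $M=m$, in which case the solutions occur as follows: the two bodies of equal mass move, diametrically opposed, on a non-equatorial circle parallel with the equator, of radius $(2\kappa)^{-1/2}$, and the third body moves on the equator; thus, given $\kappa$, the size of the equilateral triangle does not depend on the value of the equal masses, but its angular velocity does.
   Context: For $\kappa>0$ let $\mathbb S_\kappa^2=\{(x,y,z):\kappa(x^2+y^2+z^2)+2\kappa^{1/2}z=0\}\subset\mathbb R^3$, a sphere of radius $\kappa^{-1/2}$ with equator $z=-\kappa^{-1/2}$. For $\kappa<0$ let $\mathbb H_\kappa^2=\{(x,y,z):\kappa(x^2+y^2-z^2)+2|\kappa|^{1/2}z=0,\ z\ge0\}$, embedded in Minkowski space $\mathbb R^{2,1}$ with signature $(+,+,-)$. Put $\sigma=+1$ if $\kappa>0$ and $\sigma=-1$ if $\kappa<0$. Bodies have positions ${\bf r}_i=(x_i,y_i,z_i)$ on the manifold; for $\kappa>0$ they lie in the closed hemisphere $z\ge-\kappa^{-1/2}$. With $r_{ij}=[(x_i-x_j)^2+(y_i-y_j)^2+\sigma(z_i-z_j)^2]^{1/2}$ and $\dot{\bf r}_i\cdot\dot{\bf r}_i=\dot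 x_i^2+\dot y_i^2+\sigma\dot z_i^2$, the equations of motion of the curved 3-body problem are, for $i=1,2,3$, $$\ddot x_i=\sum_{j\ne i}\frac{m_j\big[x_j-\big(1-\frac{\kappa r_{ij}^2}{2}\big)x_i\big]}{r_{ij}^3\big(1-\frac{\kappa r_{ij}^2}{4}\big)^{3/2}}-\kappa(\dot{\bf r}_i\cdot\dot{\bf r}_i)x_i,$$ the same equation with $y$ in place of $x$, and $$\ddot z_i=\sum_{j\ne i}\frac{m_j\big[z_j-\big(1-\frac{\kappa r_{ij}^2}{2}\big)z_i+\frac{\sigma|\kappa|^{1/2}r_{ij}^2}{2}\big]}{r_{ij}^3\big(1-\frac{\kappa r_{ij}^2}{4}\big)^{3/2}}-(\dot{\bf r}_i\cdot\dot{\bf r}_i)(\kappa z_i+\sigma|\kappa|^{1/2}).$$ Collisions and (for $\kappa>0$) antipodal configurations are excluded. A negligible mass is a mass set equal to $0$ in these equations. With one negligible mass $m_3=0$, a Lagrangian relative equilibrium is a solution of the form $$(x_1,y_1)=(r_1\cos\alpha t,\ r_1\sin\alpha t),\quad (x_2,y_2)=(-r_2\cos\alpha t,\ -r_2\sin\alpha t),\quad (x_3,y_3)=(r_3\cos(\alpha t+\theta),\ r_3\sin(\alpha t+\theta)),$$ with constants $\alpha\ne0$, $\theta\in(0,\pi)$, $r_1,r_2,r_3>0$ (each at most $\kappa^{-1/2}$ if $\kappa>0$), and $z_i$ determined by $(x_i,y_i)$ through $z_i=-\sigma|\kappa|^{1/2}A_i/(1+\sqrt{1-\kappa A_i})$,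 $A_i=x_i^2+y_i^2$, such that the triangle is equilateral: $r_{12}=r_{13}=r_{23}$.
   Formalization: The z-equation of motion is not imposed on a body lying on the equator: with it, the stated solution for M = m fails, since the third body is pulled off the equator. Existence for M = m is thus for this reduced system; all other claims hold a fortiori for the full equations. *)

theory Defs
  imports "HOL-Analysis.Analysis"
begin

text \<open>
  Bodies are labelled 1, 2, 3; the coordinate functions \<open>x y z :: nat \<Rightarrow> real \<Rightarrow> real\<close> take a
  label and a time, and only the values at the labels 1, 2, 3 matter. The curvature \<open>\<kappa>\<close> is
  nonzero, so the sign \<open>\<sigma>\<close> of the curvature is \<open>sgn \<kappa>\<close>.
\<close>

definition on_surface :: "real \<Rightarrow> real \<Rightarrow> real \<Rightarrow> real \<Rightarrow> bool" where
  "on_surface \<kappa> a b c \<longleftrightarrow>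
     \<kappa> * (a\<^sup>2 + b\<^sup>2 + sgn \<kappa> * c\<^sup>2) + 2 * sqrt \<bar>\<kappa>\<bar> * c = 0 \<and>
     (\<kappa> > 0 \<longrightarrow> c \<ge> - (\<kappa> powr (-1/2))) \<and>
     (\<kappa> < 0 \<longrightarrow> c \<ge> 0)"

definition bdist ::
  "real \<Rightarrow> (nat \<Rightarrow> real \<Rightarrow> real) \<Rightarrow> (nat \<Rightarrow> real \<Rightarrow> real) \<Rightarrow> (nat \<Rightarrow> real \<Rightarrow> real) \<Rightarrow>
   nat \<Rightarrow> nat \<Rightarrow> real \<Rightarrow> real" where
  "bdist \<kappa> x y z i j t =
     sqrt ((x i t - x j t)\<^sup>2 + (y i t - y j t)\<^sup>2 + sgn \<kappa> * (z i t - z j t)\<^sup>2)"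

definition speed2 ::
  "real \<Rightarrow> (nat \<Rightarrow> real \<Rightarrow> real) \<Rightarrow> (nat \<Rightarrow> real \<Rightarrow> real) \<Rightarrow> (nat \<Rightarrow> real \<Rightarrow> real) \<Rightarrow>
   nat \<Rightarrow> real \<Rightarrow> real" where
  "speed2 \<kappa> x y z i t =
     (deriv (x i) t)\<^sup>2 + (deriv (y i) t)\<^sup>2 + sgn \<kappa> * (deriv (z i) t)\<^sup>2"

definition force_denom :: "real \<Rightarrow> real \<Rightarrow> real" where
  "force_denom \<kappa> d = d ^ 3 * (1 - \<kappa> * d\<^sup>2 / 4) powr (3/2)"

definition twice_differentiable :: "(real \<Rightarrow> real) \<Rightarrow> bool" where
  "twice_differentiable f \<longleftrightarrow>
     (\<forall>t. f differentiable (at t)) \<and> (\<forall>t. deriv f differentiable (at t))"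

text \<open>
  The equations for the first two coordinates have the same shape; \<open>u\<close> below is \<open>x\<close> or \<open>y\<close>.
\<close>

definition horizontal_eq ::
  "real \<Rightarrow> (nat \<Rightarrow> real) \<Rightarrow>
   (nat \<Rightarrow> real \<Rightarrow> real) \<Rightarrow> (nat \<Rightarrow> real \<Rightarrow> real) \<Rightarrow> (nat \<Rightarrow> real \<Rightarrow> real) \<Rightarrow>
   (nat \<Rightarrow> real \<Rightarrow> real) \<Rightarrow> nat \<Rightarrow> real \<Rightarrow> bool" where
  "horizontal_eq \<kappa> \<mu> x y z u i t \<longleftrightarrow>
     deriv (deriv (u i)) t =
       (\<Sum>j \<in> {1, 2, 3} - {i}.
          \<mu> j * (u j t - (1 - \<kappa> * (bdist \<kappa> x y z i j t)\<^sup>2 / 2) * u i t)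
            / force_denom \<kappa> (bdist \<kappa> x y z i j t))
       - \<kappa> * speed2 \<kappa> x y z i t * u i t"

definition vertical_eq ::
  "real \<Rightarrow> (nat \<Rightarrow> real) \<Rightarrow>
   (nat \<Rightarrow> real \<Rightarrow> real) \<Rightarrow> (nat \<Rightarrow> real \<Rightarrow> real) \<Rightarrow> (nat \<Rightarrow> real \<Rightarrow> real) \<Rightarrow>
   nat \<Rightarrow> real \<Rightarrow> bool" where
  "vertical_eq \<kappa> \<mu> x y z i t \<longleftrightarrow>
     deriv (deriv (z i)) t =
       (\<Sum>j \<in> {1, 2, 3} - {i}.
          \<mu> j * (z j t - (1 - \<kappa> * (bdist \<kappa> x y z i j t)\<^sup>2 / 2) * z i t
                  + sgn \<kappa> * sqrt \<bar>\<kappa>\<bar> * (bdist \<kappa> x y z i j t)\<^sup>2 / 2)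
            / force_denom \<kappa> (bdist \<kappa> x y z i j t))
       - speed2 \<kappa> x y z i t * (\<kappa> * z i t + sgn \<kappa> * sqrt \<bar>\<kappa>\<bar>)"

definition admissible_motion ::
  "real \<Rightarrow> (nat \<Rightarrow> real \<Rightarrow> real) \<Rightarrow> (nat \<Rightarrow> real \<Rightarrow> real) \<Rightarrow> (nat \<Rightarrow> real \<Rightarrow> real) \<Rightarrow> bool" where
  "admissible_motion \<kappa> x y z \<longleftrightarrow>
     (\<forall>i \<in> {1, 2, 3}.
        twice_differentiable (x i) \<and> twice_differentiable (y i) \<and> twice_differentiable (z i) \<and>
        (\<forall>t. on_surface \<kappa> (x i t) (y i t) (z i t))) \<and>
     (\<forall>i \<in> {1, 2, 3}. \<forall>j \<in> {1, 2, 3}. i \<noteq> j \<longrightarrow>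
        (\<forall>t. bdist \<kappa> x y z i j t \<noteq> 0 \<and> \<kappa> * (bdist \<kappa> x y z i j t)\<^sup>2 \<noteq> 4))"

definition full_solution ::
  "real \<Rightarrow> (nat \<Rightarrow> real) \<Rightarrow>
   (nat \<Rightarrow> real \<Rightarrow> real) \<Rightarrow> (nat \<Rightarrow> real \<Rightarrow> real) \<Rightarrow> (nat \<Rightarrow> real \<Rightarrow> real) \<Rightarrow> bool" where
  "full_solution \<kappa> \<mu> x y z \<longleftrightarrow>
     admissible_motion \<kappa> x y z \<and>
     (\<forall>i \<in> {1, 2, 3}. \<forall>t.
        horizontal_eq \<kappa> \<mu> x y z x i t \<and> horizontal_eq \<kappa> \<mu> x y z y i t \<and>
        vertical_eq \<kappa> \<mu> x y z i t)"

text \<open>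
  The notion of solution used in the main statement. The third coordinate is a function of the
  first two through the equation of the surface. Differentiating that equation twice gives the
  vertical equation multiplied by \<open>\<kappa> z + \<sigma> \<bar>\<kappa>\<bar>\<^sup>1\<^sup>/\<^sup>2\<close>, so off the equator the vertical equation is a
  consequence of the horizontal ones. On the equator (which exists only for \<open>\<kappa> > 0\<close>) this factor
  vanishes, the vertical equation becomes an independent condition, and it is not imposed: the
  equal-mass configuration defined below violates it, as shown at the end of this theory. For
  \<open>\<kappa> < 0\<close> the notion coincides with \<open>full_solution\<close>, and for every \<open>\<kappa>\<close> it is implied by it, so
  that nonexistence statements carry over.
\<close>

definition curved_solution ::
  "real \<Rightarrow> (nat \<Rightarrow> real) \<Rightarrow>
   (nat \<Rightarrow> real \<Rightarrow> real) \<Rightarrow> (nat \<Rightarrow> real \<Rightarrow> real) \<Rightarrow> (nat \<Rightarrow> real \<Rightarrow> real) \<Rightarrow> bool" where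
  "curved_solution \<kappa> \<mu> x y z \<longleftrightarrow>
     admissible_motion \<kappa> x y z \<and>
     (\<forall>i \<in> {1, 2, 3}. \<forall>t.
        horizontal_eq \<kappa> \<mu> x y z x i t \<and> horizontal_eq \<kappa> \<mu> x y z y i t \<and>
        (\<kappa> * z i t + sgn \<kappa> * sqrt \<bar>\<kappa>\<bar> \<noteq> 0 \<longrightarrow> vertical_eq \<kappa> \<mu> x y z i t))"

definition restricted_masses :: "real \<Rightarrow> real \<Rightarrow> nat \<Rightarrow> real" where
  "restricted_masses M m i = (if i = 1 then M else if i = 2 then m else 0)"

definition lagrangian_motion ::
  "real \<Rightarrow> real \<Rightarrow>
   (nat \<Rightarrow> real \<Rightarrow> real) \<Rightarrow> (nat \<Rightarrow> real \<Rightarrow> real) \<Rightarrow> (nat \<Rightarrow> real \<Rightarrow> real) \<Rightarrow> bool" where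
  "lagrangian_motion \<kappa> \<alpha> x y z \<longleftrightarrow>
     \<alpha> \<noteq> 0 \<and>
     (\<exists>\<theta> r1 r2 r3. 0 < \<theta> \<and> \<theta> < pi \<and> r1 > 0 \<and> r2 > 0 \<and> r3 > 0 \<and>
        (\<kappa> > 0 \<longrightarrow> r1 \<le> \<kappa> powr (-1/2) \<and> r2 \<le> \<kappa> powr (-1/2) \<and> r3 \<le> \<kappa> powr (-1/2)) \<and>
        (\<forall>t. x 1 t = r1 * cos (\<alpha> * t) \<and> y 1 t = r1 * sin (\<alpha> * t) \<and>
             x 2 t = - r2 * cos (\<alpha> * t) \<and> y 2 t = - r2 * sin (\<alpha> * t) \<and>
             x 3 t = r3 * cos (\<alpha> * t + \<theta>) \<and> y 3 t = r3 * sin (\<alpha> * t + \<theta>))) \<and>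
     (\<forall>i \<in> {1, 2, 3}. \<forall>t.
        z i t = - sgn \<kappa> * sqrt \<bar>\<kappa>\<bar> * ((x i t)\<^sup>2 + (y i t)\<^sup>2)
                  / (1 + sqrt (1 - \<kappa> * ((x i t)\<^sup>2 + (y i t)\<^sup>2)))) \<and>
     (\<forall>t. bdist \<kappa> x y z 1 2 t = bdist \<kappa> x y z 1 3 t \<and>
          bdist \<kappa> x y z 1 3 t = bdist \<kappa> x y z 2 3 t)"

definition lagrangian_RE ::
  "real \<Rightarrow> real \<Rightarrow> real \<Rightarrow> real \<Rightarrow>
   (nat \<Rightarrow> real \<Rightarrow> real) \<Rightarrow> (nat \<Rightarrow> real \<Rightarrow> real) \<Rightarrow> (nat \<Rightarrow> real \<Rightarrow> real) \<Rightarrow> bool" where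
  "lagrangian_RE \<kappa> M m \<alpha> x y z \<longleftrightarrow>
     lagrangian_motion \<kappa> \<alpha> x y z \<and> curved_solution \<kappa> (restricted_masses M m) x y z"

text \<open>
  Bodies 1 and 2 diametrically opposed on a common non-equatorial parallel of radius
  \<open>(2\<kappa>)\<^sup>-\<^sup>1\<^sup>/\<^sup>2\<close>, body 3 on the equator \<open>z = -\<kappa>\<^sup>-\<^sup>1\<^sup>/\<^sup>2\<close>.
\<close>

definition equal_mass_configuration ::
  "real \<Rightarrow> (nat \<Rightarrow> real \<Rightarrow> real) \<Rightarrow> (nat \<Rightarrow> real \<Rightarrow> real) \<Rightarrow> (nat \<Rightarrow> real \<Rightarrow> real) \<Rightarrow> bool" where
  "equal_mass_configuration \<kappa> x y z \<longleftrightarrow>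
     (\<exists>h. h \<noteq> - (\<kappa> powr (-1/2)) \<and> (\<forall>t. z 1 t = h \<and> z 2 t = h)) \<and>
     (\<forall>t. sqrt ((x 1 t)\<^sup>2 + (y 1 t)\<^sup>2) = (2 * \<kappa>) powr (-1/2) \<and>
          x 2 t = - x 1 t \<and> y 2 t = - y 1 t \<and>
          z 3 t = - (\<kappa> powr (-1/2)))"

lemma full_solution_imp_curved_solution:
  "full_solution \<kappa> \<mu> x y z \<Longrightarrow> curved_solution \<kappa> \<mu> x y z"
  by (auto simp: full_solution_def curved_solution_def)

lemma full_solution_not_equal_mass_configuration:
  assumes "\<kappa> > 0" and "m > 0" and conf: "equal_mass_configuration \<kappa> x y z"
  shows "\<not> full_solution \<kappa> (restricted_masses m m) x y z"
proof
  assume sol: "full_solution \<kappa> (restricted_masses m m) x y z"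
  define e where "e = - (\<kappa> powr (-1/2))"
  define D where "D j = force_denom \<kappa> (bdist \<kappa> x y z 3 j 0)" for j
  have e: "\<kappa> * e + sqrt \<kappa> = 0"
    using \<open>\<kappa> > 0\<close> unfolding e_def
    by (simp add: powr_minus_divide powr_half_sqrt real_div_sqrt)
  obtain h where h: "h \<noteq> e" "z 1 0 = h" "z 2 0 = h"
    using conf unfolding equal_mass_configuration_def e_def by blast
  have z3: "z 3 = (\<lambda>_. e)"
    using conf unfolding equal_mass_configuration_def e_def by auto
  have adm: "admissible_motion \<kappa> x y z"
    using sol by (simp add: full_solution_def)
  have "z 1 0 \<ge> e"
    using adm \<open>\<kappa> > 0\<close> unfolding admissible_motion_def on_surface_def e_def by blast
  then have "h > e" using h by simp
  have D: "D j > 0" if "j \<in> {1, 2}" for j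
  proof -
    have "bdist \<kappa> x y z 3 j 0 \<noteq> 0" "\<kappa> * (bdist \<kappa> x y z 3 j 0)\<^sup>2 \<noteq> 4"
      using adm that unfolding admissible_motion_def by auto
    moreover have "bdist \<kappa> x y z 3 j 0 \<ge> 0"
      using \<open>\<kappa> > 0\<close> by (simp add: bdist_def)
    ultimately show ?thesis
      unfolding D_def force_denom_def by (intro mult_pos_pos) auto
  qed
  have bracket: "h - (1 - \<kappa> * d / 2) * e + sqrt \<kappa> * d / 2 = h - e" for d
  proof -
    have "h - (1 - \<kappa> * d / 2) * e + sqrt \<kappa> * d / 2 = h - e + d / 2 * (\<kappa> * e + sqrt \<kappa>)"
      by (simp add: algebra_simps)
    then show ?thesis using e by simp
  qed
  have set: "{1, 2, 3} - {3::nat} = {1, 2}" by auto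
  have "vertical_eq \<kappa> (restricted_masses m m) x y z 3 0"
    using sol by (simp add: full_solution_def)
  then have "0 = m * (h - e) / D 1 + m * (h - e) / D 2"
    unfolding vertical_eq_def set
    using h \<open>\<kappa> > 0\<close> e
    by (simp add: bracket z3 restricted_masses_def D_def)
  moreover have "m * (h - e) / D 1 > 0" "m * (h - e) / D 2 > 0"
    using D \<open>m > 0\<close> \<open>h > e\<close> by simp_all
  ultimately show False by simp
qed

end

theory Submission
  imports Defs
begin

text \<open>
  Put \<open>s\<^sub>i = (1 - \<kappa> r\<^sub>i\<^sup>2)\<^sup>1\<^sup>/\<^sup>2\<close>, let \<open>c = 1 - \<kappa> d\<^sup>2 / 2\<close> be the (hyperbolic) cosine of the common
  side, and \<open>\<beta> = \<alpha>\<^sup>2 D\<close> with \<open>D\<close> the common denominator of the forces. The equations of motion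
  reduce to \<open>\<beta> s\<^sub>1\<^sup>2 = M + c m\<close>, \<open>\<beta> s\<^sub>2\<^sup>2 = m + c M\<close>, \<open>\<beta> s\<^sub>3\<^sup>2 = (M + m) c\<close> and \<open>M r\<^sub>1 = m r\<^sub>2\<close>.
  If \<open>M \<noteq> m\<close>, eliminating \<open>\<beta>\<close> leaves \<open>(M + c m)(m + c M) = (M + m)\<^sup>2\<close>, whose only root with
  \<open>c \<ge> 0\<close> is the collision \<open>c = 1\<close>. If \<open>M = m\<close>, the same elimination leaves \<open>c = 0\<close> or \<open>c = 1\<close>,
  and \<open>c = 0\<close> forces \<open>\<kappa> > 0\<close> and the stated configuration, with \<open>\<beta> = 2 m\<close>.
\<close>

section \<open>Sinusoids and the height of a body\<close>

text \<open>The derivative is kept in the shape of a cosine plus a sine term, so the same rule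
  applies again to give second derivatives; the horizontal coordinates of every rotating body have
  this shape.\<close>

lemma has_deriv_trig:
  fixes \<alpha> a b :: real
  shows "((\<lambda>t. a * cos (\<alpha> * t) + b * sin (\<alpha> * t)) has_real_derivative
     (\<alpha> * b) * cos (\<alpha> * t) + (- (\<alpha> * a)) * sin (\<alpha> * t)) (at t)"
  by (auto intro!: derivative_eq_intros simp: algebra_simps)

lemma deriv_trig:
  fixes \<alpha> a b :: real
  shows "deriv (\<lambda>t. a * cos (\<alpha> * t) + b * sin (\<alpha> * t)) =
    (\<lambda>t. (\<alpha> * b) * cos (\<alpha> * t) + (- (\<alpha> * a)) * sin (\<alpha> * t))"
  by (rule ext, rule DERIV_imp_deriv, rule has_deriv_trig)

lemma twice_differentiable_trig:
  "twice_differentiable (\<lambda>t. a * cos (\<alpha> * t) + b * sin (\<alpha> * t))"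
  unfolding twice_differentiable_def deriv_trig
  using has_deriv_trig real_differentiable_def by blast

text \<open>Rationalisation: the root s satisfies (s - 1)(s + 1) = -\<kappa> A. The right-hand form
  is affine in s and shows that s is the rescaled height above the centre, which lies at height -1 /
  \<open>sqrt \<bar>\<kappa>\<bar>\<close>.\<close>

lemma height_eq:
  fixes \<kappa> A :: real
  assumes "\<kappa> \<noteq> 0" and "\<kappa> * A \<le> 1"
  shows "- sgn \<kappa> * sqrt \<bar>\<kappa>\<bar> * A / (1 + sqrt (1 - \<kappa> * A)) = (sqrt (1 - \<kappa> * A) - 1) / sqrt \<bar>\<kappa>\<bar>"
proof -
  define s where "s = sqrt (1 - \<kappa> * A)"
  have s: "s \<ge> 0" "s\<^sup>2 = 1 - \<kappa> * A" using assms by (auto simp: s_def)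
  have q: "sqrt \<bar>\<kappa>\<bar> * sqrt \<bar>\<kappa>\<bar> = sgn \<kappa> * \<kappa>" "sqrt \<bar>\<kappa>\<bar> \<noteq> 0"
    using assms by (auto simp: abs_real_def sgn_real_def)
  have "- sgn \<kappa> * sqrt \<bar>\<kappa>\<bar> * A * sqrt \<bar>\<kappa>\<bar> = - (sgn \<kappa> * sgn \<kappa>) * (\<kappa> * A)"
    using q(1) by algebra
  also have "\<dots> = (s - 1) * (1 + s)"
    using s(2) assms by (simp add: sgn_real_def power2_eq_square algebra_simps)
  finally show ?thesis
    unfolding s_def[symmetric] using s(1) q(2) by (subst frac_eq_eq) auto
qed

section \<open>Equations of motion for rigid rotation about the vertical axis\<close>

text \<open>
  The triangle rotates rigidly from initial horizontal positions \<open>(a\<^sub>i, b\<^sub>i)\<close>; up to the factor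
  \<open>\<bar>\<kappa>\<bar>\<^sup>1\<^sup>/\<^sup>2\<close>, \<open>s\<^sub>i\<close> is the height over the centre of the sphere or hyperboloid.
\<close>

locale rotating_bodies =
  fixes \<kappa> \<alpha> :: real and x y z :: "nat \<Rightarrow> real \<Rightarrow> real" and a b s :: "nat \<Rightarrow> real"
  assumes curv: "\<kappa> \<noteq> 0"
    and xrot: "i \<in> {1, 2, 3} \<Longrightarrow> x i = (\<lambda>t. a i * cos (\<alpha> * t) + (- b i) * sin (\<alpha> * t))"
    and yrot: "i \<in> {1, 2, 3} \<Longrightarrow> y i = (\<lambda>t. b i * cos (\<alpha> * t) + a i * sin (\<alpha> * t))"
    and zrot: "i \<in> {1, 2, 3} \<Longrightarrow> z i = (\<lambda>t. (s i - 1) / sqrt \<bar>\<kappa>\<bar>)"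
    and s_nonneg: "i \<in> {1, 2, 3} \<Longrightarrow> s i \<ge> 0"
    and s_square: "i \<in> {1, 2, 3} \<Longrightarrow> (s i)\<^sup>2 = 1 - \<kappa> * ((a i)\<^sup>2 + (b i)\<^sup>2)"
begin

lemma norm_xy: "i \<in> {1, 2, 3} \<Longrightarrow> (x i t)\<^sup>2 + (y i t)\<^sup>2 = (a i)\<^sup>2 + (b i)\<^sup>2"
  using sin_cos_squared_add[of "\<alpha> * t"] unfolding xrot yrot by algebra

lemma inner_xy:
  "i \<in> {1, 2, 3} \<Longrightarrow> j \<in> {1, 2, 3} \<Longrightarrow> x i t * x j t + y i t * y j t = a i * a j + b i * b j"
  using sin_cos_squared_add[of "\<alpha> * t"] unfolding xrot yrot by algebra

text \<open>\<kappa> times the (Lorentz) inner product of the position vectors taken from the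
  centre: the cosine, or hyperbolic cosine, of the geodesic distance measured in curvature
  radii.\<close>

definition cosd :: "nat \<Rightarrow> nat \<Rightarrow> real" where
  "cosd i j = \<kappa> * (a i * a j + b i * b j) + s i * s j"

text \<open>The chord formula: centred position vectors have \<kappa>-scaled square norm 1, so the
  square of their difference is 2(1 - cos) / \<kappa>. Time drops out because rotation preserves
  inner products.\<close>

lemma bdist_eq:
  assumes i: "i \<in> {1, 2, 3}" and j: "j \<in> {1, 2, 3}"
  shows "bdist \<kappa> x y z i j t = sqrt (2 * (1 - cosd i j) / \<kappa>)"
proof -
  have sg: "sgn \<kappa> * ((s i - s j) / sqrt \<bar>\<kappa>\<bar>)\<^sup>2 = (s i - s j)\<^sup>2 / \<kappa>"
    using curv by (simp add: power_divide sgn_real_def abs_real_def)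
  have "z i t - z j t = (s i - s j) / sqrt \<bar>\<kappa>\<bar>"
    unfolding zrot[OF i] zrot[OF j] by (simp add: diff_divide_distrib)
  moreover have "(x i t - x j t)\<^sup>2 + (y i t - y j t)\<^sup>2
      = ((a i)\<^sup>2 + (b i)\<^sup>2) + ((a j)\<^sup>2 + (b j)\<^sup>2) - 2 * (a i * a j + b i * b j)"
    unfolding norm_xy[OF i, symmetric, of t] norm_xy[OF j, symmetric, of t]
      inner_xy[OF i j, symmetric, of t] by algebra
  ultimately have "\<kappa> * ((x i t - x j t)\<^sup>2 + (y i t - y j t)\<^sup>2 + sgn \<kappa> * (z i t - z j t)\<^sup>2)
      = \<kappa> * (((a i)\<^sup>2 + (b i)\<^sup>2) + ((a j)\<^sup>2 + (b j)\<^sup>2) - 2 * (a i * a j + b i * b j)) + (s i - s j)\<^sup>2"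
    using curv by (simp add: sg distrib_left)
  also have "\<dots> = 2 * (1 - cosd i j)"
    using s_square[OF i] s_square[OF j] unfolding cosd_def by algebra
  finally show ?thesis
    unfolding bdist_def using curv by (simp add: nonzero_eq_divide_eq mult.commute)
qed

lemma speed2_eq:
  assumes i: "i \<in> {1, 2, 3}"
  shows "speed2 \<kappa> x y z i t = \<alpha>\<^sup>2 * ((a i)\<^sup>2 + (b i)\<^sup>2)"
  using sin_cos_squared_add[of "\<alpha> * t"]
  unfolding speed2_def xrot[OF i] yrot[OF i] zrot[OF i] deriv_trig deriv_const
    power_zero_numeral mult_zero_right add_0_right by algebra

lemma second_deriv_x: "i \<in> {1, 2, 3} \<Longrightarrow> deriv (deriv (x i)) t = - \<alpha>\<^sup>2 * x i t"
  unfolding xrot deriv_trig by algebra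

lemma second_deriv_y: "i \<in> {1, 2, 3} \<Longrightarrow> deriv (deriv (y i)) t = - \<alpha>\<^sup>2 * y i t"
  unfolding yrot deriv_trig by algebra

text \<open>The acceleration is centripetal, and the constraint term has the same direction;
  together they leave the factor 1 - \<kappa>(a^2 + b^2), which is the squared height.\<close>

lemma horizontal_eq_iff:
  assumes i: "i \<in> {1, 2, 3}" and u: "u = x \<or> u = y"
    and d: "\<forall>j \<in> {1, 2, 3} - {i}. bdist \<kappa> x y z i j t = d" and c: "1 - \<kappa> * d\<^sup>2 / 2 = c"
  shows "horizontal_eq \<kappa> \<mu> x y z u i t \<longleftrightarrow>
    (\<Sum>j \<in> {1, 2, 3} - {i}. \<mu> j * (u j t - c * u i t)) / force_denom \<kappa> d
      = - \<alpha>\<^sup>2 * (s i)\<^sup>2 * u i t"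
proof -
  have "deriv (deriv (u i)) t = - \<alpha>\<^sup>2 * u i t"
    using u second_deriv_x[OF i] second_deriv_y[OF i] by auto
  moreover have "- \<alpha>\<^sup>2 * u i t + \<kappa> * speed2 \<kappa> x y z i t * u i t = - \<alpha>\<^sup>2 * (s i)\<^sup>2 * u i t"
    unfolding speed2_eq[OF i] s_square[OF i] by algebra
  ultimately show ?thesis
    using d c unfolding horizontal_eq_def by (auto simp: sum_divide_distrib)
qed

text \<open>Heights are constant, so the vertical forces must balance the constraint term. This form
  serves to check the two bodies off the equator in the existence proof.\<close>

lemma vertical_eq_iff:
  assumes i: "i \<in> {1, 2, 3}"
    and d: "\<forall>j \<in> {1, 2, 3} - {i}. bdist \<kappa> x y z i j t = d" and c: "1 - \<kappa> * d\<^sup>2 / 2 = c"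
  shows "vertical_eq \<kappa> \<mu> x y z i t \<longleftrightarrow>
    (\<Sum>j \<in> {1, 2, 3} - {i}. \<mu> j * (s j - c * s i)) / force_denom \<kappa> d = \<alpha>\<^sup>2 * (1 - (s i)\<^sup>2) * s i"
proof -
  define q where "q = sqrt \<bar>\<kappa>\<bar>"
  have q: "q \<noteq> 0" "q * q = sgn \<kappa> * \<kappa>" "sgn \<kappa> * sgn \<kappa> = 1"
    using curv by (auto simp: q_def abs_real_def sgn_real_def)
  have "deriv (deriv (z i)) t = 0"
    unfolding zrot[OF i] by simp
  \<comment> \<open>After multiplication by q, heights become s - 1. The resulting constants c - 1 +
    \<kappa> d^2 / 2 add up to 0: the last term of the bracket undoes the shift of the origin away
    from the centre.\<close>
  moreover have bracket: "z j t - (1 - \<kappa> * d\<^sup>2 / 2) * z i t + sgn \<kappa> * q * d\<^sup>2 / 2 = (s j - c * s i) / q"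
    if "j \<in> {1, 2, 3} - {i}" for j
  proof -
    have "q * z i t = s i - 1" "q * z j t = s j - 1"
      using that q(1) by (simp_all only: zrot[OF i] zrot[of j] Diff_iff q_def[symmetric]) auto
    then have "q * (z j t - c * z i t + sgn \<kappa> * q * d\<^sup>2 / 2) = s j - c * s i"
      using q(2,3) c by algebra
    then show ?thesis using q(1) unfolding c by (simp add: nonzero_eq_divide_eq mult.commute)
  qed
  moreover have "speed2 \<kappa> x y z i t * (\<kappa> * z i t + sgn \<kappa> * q) = \<alpha>\<^sup>2 * (1 - (s i)\<^sup>2) * s i / q"
  proof -
    have "q * z i t = s i - 1" unfolding zrot[OF i] using q(1) by (simp add: q_def)
    then have "q * (\<kappa> * z i t + sgn \<kappa> * q) = \<kappa> * s i" using q(2,3) by algebra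
    moreover have "\<kappa> * speed2 \<kappa> x y z i t = \<alpha>\<^sup>2 * (1 - (s i)\<^sup>2)"
      unfolding speed2_eq[OF i] s_square[OF i] by algebra
    ultimately have "q * (speed2 \<kappa> x y z i t * (\<kappa> * z i t + sgn \<kappa> * q)) = \<alpha>\<^sup>2 * (1 - (s i)\<^sup>2) * s i"
      by algebra
    then show ?thesis using q(1) by (simp add: nonzero_eq_divide_eq mult.commute)
  qed
  moreover have "(\<Sum>j \<in> {1, 2, 3} - {i}.
      \<mu> j * (z j t - (1 - \<kappa> * (bdist \<kappa> x y z i j t)\<^sup>2 / 2) * z i t
        + sgn \<kappa> * q * (bdist \<kappa> x y z i j t)\<^sup>2 / 2) / force_denom \<kappa> (bdist \<kappa> x y z i j t))
      = (\<Sum>j \<in> {1, 2, 3} - {i}. \<mu> j * (s j - c * s i)) / force_denom \<kappa> d / q"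
    unfolding sum_divide_distrib
    by (rule sum.cong) (use d in \<open>simp_all only: bracket, simp add: mult.commute\<close>)
  ultimately have "vertical_eq \<kappa> \<mu> x y z i t \<longleftrightarrow>
    0 = ((\<Sum>j \<in> {1, 2, 3} - {i}. \<mu> j * (s j - c * s i)) / force_denom \<kappa> d) / q
      - \<alpha>\<^sup>2 * (1 - (s i)\<^sup>2) * s i / q"
    unfolding vertical_eq_def q_def[symmetric] by presburger
  also have "\<dots> \<longleftrightarrow>
    (\<Sum>j \<in> {1, 2, 3} - {i}. \<mu> j * (s j - c * s i)) / force_denom \<kappa> d = \<alpha>\<^sup>2 * (1 - (s i)\<^sup>2) * s i"
    using q(1) by (simp only: diff_divide_distrib[symmetric]) simp
  finally show ?thesis .
qed

text \<open>Each s is a cosine in [0, 1] on the hemisphere and a hyperbolic cosine, at least 1, on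
  the hyperboloid. The purpose is to show that 1 - c has the sign of \<kappa>.\<close>

lemma height_product_sign:
  assumes i: "i \<in> {1, 2, 3}" and j: "j \<in> {1, 2, 3}"
  shows "s i * s j \<le> 1 \<and> \<kappa> > 0 \<or> 1 \<le> s i * s j \<and> \<kappa> < 0"
proof (cases "\<kappa> > 0")
  case True
  have "s k \<le> 1" if "k \<in> {1, 2, 3}" for k
  proof -
    have "(s k)\<^sup>2 \<le> 1\<^sup>2" using s_square[OF that] True by simp
    then show ?thesis by (rule power2_le_imp_le) simp
  qed
  then show ?thesis using True i j s_nonneg by (auto intro!: mult_le_one)
next
  case False
  then have neg: "\<kappa> < 0" using curv by simp
  have "s k \<ge> 1" if "k \<in> {1, 2, 3}" for k
  proof -
    have "\<kappa> * ((a k)\<^sup>2 + (b k)\<^sup>2) \<le> 0" using neg by (simp add: mult_nonpos_nonneg)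
    then have "1\<^sup>2 \<le> (s k)\<^sup>2" using s_square[OF that] by simp
    then show ?thesis using s_nonneg[OF that] by (rule power2_le_imp_le)
  qed
  then have "1 \<le> s i * s j" using i j mult_mono[of 1 "s i" 1 "s j"] s_nonneg by fastforce
  then show ?thesis using neg by simp
qed

end

section \<open>Reduction of a Lagrangian relative equilibrium to algebraic equations\<close>

lemma lagrangian_motion_rotating:
  assumes "\<kappa> \<noteq> 0" and "lagrangian_motion \<kappa> \<alpha> x y z"
  obtains \<theta> r1 r2 r3 s where "0 < \<theta>" "\<theta> < pi" "r1 > 0" "r2 > 0" "r3 > 0"
    "rotating_bodies \<kappa> \<alpha> x y z
       (\<lambda>i. if i = 1 then r1 else if i = 2 then - r2 else r3 * cos \<theta>)
       (\<lambda>i. if i = 1 then 0 else if i = 2 then 0 else r3 * sin \<theta>) s"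
proof -
  obtain \<theta> r1 r2 r3 where r: "0 < \<theta>" "\<theta> < pi" "r1 > 0" "r2 > 0" "r3 > 0"
    and ub: "\<kappa> > 0 \<longrightarrow> r1 \<le> \<kappa> powr (-1/2) \<and> r2 \<le> \<kappa> powr (-1/2) \<and> r3 \<le> \<kappa> powr (-1/2)"
    and xy: "\<And>t. x 1 t = r1 * cos (\<alpha> * t) \<and> y 1 t = r1 * sin (\<alpha> * t) \<and>
             x 2 t = - r2 * cos (\<alpha> * t) \<and> y 2 t = - r2 * sin (\<alpha> * t) \<and>
             x 3 t = r3 * cos (\<alpha> * t + \<theta>) \<and> y 3 t = r3 * sin (\<alpha> * t + \<theta>)"
    using assms(2) unfolding lagrangian_motion_def by blast
  have z: "z i t = - sgn \<kappa> * sqrt \<bar>\<kappa>\<bar> * ((x i t)\<^sup>2 + (y i t)\<^sup>2)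
                  / (1 + sqrt (1 - \<kappa> * ((x i t)\<^sup>2 + (y i t)\<^sup>2)))" if "i \<in> {1, 2, 3}" for i t
    using assms(2) that unfolding lagrangian_motion_def by blast
  define \<rho> where "\<rho> = (\<lambda>i::nat. if i = 1 then r1 else if i = 2 then r2 else r3)"
  define s where "s i = sqrt (1 - \<kappa> * (\<rho> i)\<^sup>2)" for i
  \<comment> \<open>This keeps the argument of the root in \<open>s\<close> nonnegative, so that
    \<open>s\<close> really squares to it. For positive curvature it is the bound on the
    radii.\<close>
  have small: "\<kappa> * \<rho>'\<^sup>2 \<le> 1" if "\<rho>' > 0" "\<kappa> > 0 \<longrightarrow> \<rho>' \<le> \<kappa> powr (-1/2)" for \<rho>'
  proof (cases "\<kappa> > 0")
    case True
    have "\<rho>'\<^sup>2 \<le> (\<kappa> powr (-1/2))\<^sup>2" using True that by (intro power_mono) auto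
    also have "\<dots> = 1 / \<kappa>"
      using True by (simp add: powr_minus_divide powr_half_sqrt power_divide)
    finally show ?thesis using True by (simp add: field_simps)
  next
    case False
    then have "\<kappa> * \<rho>'\<^sup>2 \<le> 0" by (simp add: mult_nonpos_nonneg)
    then show ?thesis by simp
  qed
  have \<rho>: "\<kappa> * (\<rho> i)\<^sup>2 \<le> 1" for i
    unfolding \<rho>_def using small r ub by auto
  have norm: "(x i t)\<^sup>2 + (y i t)\<^sup>2 = (\<rho> i)\<^sup>2" if "i \<in> {1, 2, 3}" for i t
    using that xy[of t] by (auto simp: \<rho>_def power_mult_distrib simp flip: distrib_left)
  have "rotating_bodies \<kappa> \<alpha> x y z
       (\<lambda>i. if i = 1 then r1 else if i = 2 then - r2 else r3 * cos \<theta>)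
       (\<lambda>i. if i = 1 then 0 else if i = 2 then 0 else r3 * sin \<theta>) s"
  proof (unfold_locales, goal_cases)
    case 1
    then show ?case by (rule assms(1))
  next
    case (2 i)
    then show ?case using xy by (auto simp: cos_add algebra_simps)
  next
    case (3 i)
    then show ?case using xy by (auto simp: sin_add algebra_simps)
  next
    case (4 i)
    then show ?case
      using z norm height_eq[OF assms(1) \<rho>] by (auto simp: s_def)
  next
    case (5 i)
    then show ?case using \<rho> by (simp add: s_def)
  next
    case (6 i)
    then show ?case
      using \<rho>[of i] by (auto simp: s_def \<rho>_def power_mult_distrib simp flip: distrib_left)
  qed
  with r that show thesis by blast
qed

text \<open>The equations are read off at time 0, when bodies 1 and 2 lie on the first axis: their
  first coordinates give one relation each, and the two coordinates of body 3 give the other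
  two.\<close>

lemma lagrangian_RE_equations:
  assumes "\<kappa> \<noteq> 0" and RE: "lagrangian_RE \<kappa> M m \<alpha> x y z"
  obtains \<theta> r1 r2 r3 s1 s2 s3 c d \<beta> where
    "r1 > 0" "r2 > 0" "s1 \<ge> 0" "s2 \<ge> 0" "s3 \<ge> 0"
    "s1\<^sup>2 = 1 - \<kappa> * r1\<^sup>2" "s2\<^sup>2 = 1 - \<kappa> * r2\<^sup>2"
    "c = s1 * s2 - \<kappa> * r1 * r2"
    "c = s1 * s3 + \<kappa> * r1 * r3 * cos \<theta>"
    "c = s2 * s3 - \<kappa> * r2 * r3 * cos \<theta>"
    "\<beta> * s1\<^sup>2 * r1 = m * (r2 + c * r1)" "\<beta> * s2\<^sup>2 * r2 = M * (r1 + c * r2)"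
    "\<beta> * s3\<^sup>2 = (M + m) * c" "M * r1 = m * r2"
    "\<beta> = \<alpha>\<^sup>2 * force_denom \<kappa> d" "\<beta> > 0" "c \<noteq> 1"
    "\<And>t. bdist \<kappa> x y z 1 2 t = d" "d\<^sup>2 = 2 * (1 - c) / \<kappa>"
    "\<And>t. x 1 t = r1 * cos (\<alpha> * t) \<and> y 1 t = r1 * sin (\<alpha> * t) \<and>
      x 2 t = - r2 * cos (\<alpha> * t) \<and> y 2 t = - r2 * sin (\<alpha> * t)"
    "\<And>t. z 1 t = (s1 - 1) / sqrt \<bar>\<kappa>\<bar> \<and> z 2 t = (s2 - 1) / sqrt \<bar>\<kappa>\<bar> \<and> z 3 t = (s3 - 1) / sqrt \<bar>\<kappa>\<bar>"
proof -
  have mot: "lagrangian_motion \<kappa> \<alpha> x y z"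
    and sol: "curved_solution \<kappa> (restricted_masses M m) x y z"
    using RE by (auto simp: lagrangian_RE_def)
  obtain \<theta> r1 r2 r3 s where r: "0 < \<theta>" "\<theta> < pi" "r1 > 0" "r2 > 0" "r3 > 0"
    and rot: "rotating_bodies \<kappa> \<alpha> x y z
       (\<lambda>i. if i = 1 then r1 else if i = 2 then - r2 else r3 * cos \<theta>)
       (\<lambda>i. if i = 1 then 0 else if i = 2 then 0 else r3 * sin \<theta>) s"
    by (rule lagrangian_motion_rotating[OF assms(1) mot])
  interpret rotating_bodies \<kappa> \<alpha> x y z
       "\<lambda>i. if i = 1 then r1 else if i = 2 then - r2 else r3 * cos \<theta>"
       "\<lambda>i. if i = 1 then 0 else if i = 2 then 0 else r3 * sin \<theta>" s by (rule rot)
  define c where "c = cosd 1 2"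
  define d where "d = sqrt (2 * (1 - c) / \<kappa>)"
  define D where "D = force_denom \<kappa> d"
  define \<beta> where "\<beta> = \<alpha>\<^sup>2 * D"
  have c12: "c = s 1 * s 2 - \<kappa> * r1 * r2" unfolding c_def cosd_def by simp
  have "0 < r1 * r2" using r by simp
  then have kr: "\<kappa> > 0 \<longrightarrow> \<kappa> * r1 * r2 > 0" "\<kappa> < 0 \<longrightarrow> \<kappa> * r1 * r2 < 0"
    by (auto simp: mult.assoc mult_neg_pos)
  \<comment> \<open>The sign matters because \<open>sqrt\<close> is odd on the reals: for a negative
    argument \<open>d\<^sup>2\<close> would be the negative of the quotient.\<close>
  have nonneg: "0 \<le> 2 * (1 - c) / \<kappa>"
  proof (cases "\<kappa> > 0")
    case True
    then have "1 - c \<ge> 0" using height_product_sign[of 1 2] kr unfolding c12 by auto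
    then show ?thesis using True by simp
  next
    case False
    then have "1 - c \<le> 0" using height_product_sign[of 1 2] kr unfolding c12 by auto
    then show ?thesis using False by (simp add: divide_nonpos_nonpos)
  qed
  then have d2: "d\<^sup>2 = 2 * (1 - c) / \<kappa>" by (simp add: d_def)
  have cd: "1 - \<kappa> * d\<^sup>2 / 2 = c" using curv d2 by (simp add: field_simps)
  have dist12: "bdist \<kappa> x y z 1 2 t = d" for t
    using bdist_eq[of 1 2 t] unfolding d_def c_def by simp
  have dist13: "bdist \<kappa> x y z 1 3 t = d" and dist23: "bdist \<kappa> x y z 2 3 t = d" for t
    using mot dist12 unfolding lagrangian_motion_def by auto
  have sym: "bdist \<kappa> x y z i j t = bdist \<kappa> x y z j i t" for i j t
    by (simp add: bdist_def power2_commute)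
  have dists: "\<forall>j \<in> {1, 2, 3} - {i}. bdist \<kappa> x y z i j t = d" if "i \<in> {1, 2, 3}" for i t
    using that dist12 dist13 dist23 sym by auto
  \<comment> \<open>\<open>sqrt\<close> is injective on all reals, so equal sides have equal
    cosines.\<close>
  have cosds: "cosd i j = c" if "i \<in> {1, 2, 3}" "j \<in> {1, 2, 3}" "i \<noteq> j" for i j
    using dists[of i 0] bdist_eq[of i j 0] that curv unfolding d_def by auto
  have adm: "d \<noteq> 0" "\<kappa> * d\<^sup>2 \<noteq> 4"
    using sol dist12 unfolding curved_solution_def admissible_motion_def
    by (metis insertCI one_eq_numeral_iff semiring_norm(83))+
  have "d \<ge> 0" unfolding d_def using nonneg by (rule real_sqrt_ge_zero)
  then have "d > 0" using adm(1) by simp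
  then have D: "D > 0" using adm(2) by (simp add: D_def force_denom_def)
  have alpha: "\<alpha> \<noteq> 0" using mot by (simp add: lagrangian_motion_def)
  have hor: "(\<Sum>j \<in> {1, 2, 3} - {i}. restricted_masses M m j * (u j 0 - c * u i 0))
      = - \<beta> * (s i)\<^sup>2 * u i 0" if "i \<in> {1, 2, 3}" "u = x \<or> u = y" for i u
  proof -
    have "horizontal_eq \<kappa> (restricted_masses M m) x y z u i 0"
      using sol that unfolding curved_solution_def by blast
    then show ?thesis
      using D unfolding horizontal_eq_iff[OF that dists[OF that(1)] cd]
      by (simp add: D_def[symmetric] \<beta>_def nonzero_divide_eq_eq mult_ac)
  qed
  have sets: "{1, 2, 3} - {1} = {2, 3 :: nat}" "{1, 2, 3} - {2} = {1, 3 :: nat}"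
    "{1, 2, 3} - {3} = {1, 2 :: nat}" by auto
  have init: "x 1 0 = r1" "x 2 0 = - r2" "x 3 0 = r3 * cos \<theta>" "y 1 0 = 0" "y 2 0 = 0"
    "y 3 0 = r3 * sin \<theta>"
    by (simp_all add: xrot yrot)
  \<comment> \<open>Since \<theta> lies strictly between 0 and pi, body 3 is off the line of the
    other two, and its second coordinate can be cancelled.\<close>
  have "sin \<theta> > 0" using r sin_gt_zero by simp
  have e1: "\<beta> * (s 1)\<^sup>2 * r1 = m * (r2 + c * r1)"
    using hor[of 1 x] unfolding sets by (simp add: init restricted_masses_def algebra_simps del: One_nat_def)
  have e2: "\<beta> * (s 2)\<^sup>2 * r2 = M * (r1 + c * r2)"
    using hor[of 2 x] unfolding sets by (simp add: init restricted_masses_def algebra_simps del: One_nat_def)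
  have "(\<beta> * (s 3)\<^sup>2) * (r3 * sin \<theta>) = ((M + m) * c) * (r3 * sin \<theta>)"
    using hor[of 3 y] unfolding sets by (simp add: init restricted_masses_def algebra_simps del: One_nat_def)
  then have e3: "\<beta> * (s 3)\<^sup>2 = (M + m) * c" using r \<open>sin \<theta> > 0\<close> by simp
  \<comment> \<open>Inserting \<open>e3\<close> cancels every term with cos \<theta>; what is left
    is the centre-of-mass relation.\<close>
  have "M * (r1 - c * (r3 * cos \<theta>)) + m * (- r2 - c * (r3 * cos \<theta>)) = - (\<beta> * (s 3)\<^sup>2) * (r3 * cos \<theta>)"
    using hor[of 3 x] unfolding sets by (simp add: init restricted_masses_def algebra_simps del: One_nat_def)
  then have e4: "M * r1 = m * r2" unfolding e3 by algebra
  show thesis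
  proof (rule that[of r1 r2 "s 1" "s 2" "s 3" c r3 \<theta> \<beta> d])
    show "c = s 1 * s 3 + \<kappa> * r1 * r3 * cos \<theta>" using cosds[of 1 3] unfolding cosd_def by simp
    show "c = s 2 * s 3 - \<kappa> * r2 * r3 * cos \<theta>" using cosds[of 2 3] unfolding cosd_def by simp
    show "\<beta> > 0" using D alpha by (simp add: \<beta>_def)
    show "c \<noteq> 1" using adm(1) d2 by auto
    show "x 1 t = r1 * cos (\<alpha> * t) \<and> y 1 t = r1 * sin (\<alpha> * t) \<and>
      x 2 t = - r2 * cos (\<alpha> * t) \<and> y 2 t = - r2 * sin (\<alpha> * t)" for t
      by (simp add: xrot yrot)
  qed (use r e1 e2 e3 e4 c12 d2 dist12 s_nonneg s_square[of 1] s_square[of 2] zrot in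
      \<open>auto simp: \<beta>_def D_def\<close>)
qed

section \<open>Solving the algebraic system\<close>

text \<open>Distinct masses allow \<beta> to be solved for in terms of c; the definition of c as a
  cosine then becomes a polynomial equation in c alone.\<close>

lemma unequal_masses_imp_collision:
  fixes M m \<kappa> r1 r2 s1 s2 c \<beta> :: real
  assumes pos: "M > 0" "m > 0" "r1 > 0" "r2 > 0" and "c \<ge> 0" and "M \<noteq> m"
    and s1: "s1\<^sup>2 = 1 - \<kappa> * r1\<^sup>2" and s2: "s2\<^sup>2 = 1 - \<kappa> * r2\<^sup>2"
    and c: "c = s1 * s2 - \<kappa> * r1 * r2"
    and b1: "\<beta> * s1\<^sup>2 = M + c * m" and b2: "\<beta> * s2\<^sup>2 = m + c * M"
    and cm: "M * r1 = m * r2"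
  shows "c = 1"
proof -
  \<comment> \<open>The brackets are \<beta> \<kappa> r1^2 and \<beta> \<kappa> r2^2, and M r1 = m
    r2 balances them.\<close>
  have "M\<^sup>2 * (\<beta> - (M + c * m)) = m\<^sup>2 * (\<beta> - (m + c * M))"
    using s1 s2 b1 b2 cm by algebra
  then have "(M - m) * ((M + m) * \<beta>) = (M - m) * (M\<^sup>2 + M * m + m\<^sup>2 + c * M * m)"
    by algebra
  then have \<beta>: "(M + m) * \<beta> = M\<^sup>2 + M * m + m\<^sup>2 + c * M * m"
    using \<open>M \<noteq> m\<close> by simp
  have "m * ((M + m) * (\<beta> * \<kappa> * r1 * r2)) = m * ((1 - c) * M * m)"
    using \<beta> cm s1 b1 by algebra
  then have k: "(M + m) * (\<beta> * \<kappa> * r1 * r2) = (1 - c) * M * m" using pos by simp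
  \<comment> \<open>S is computed twice: its square is the product of \<open>b1\<close> and
    \<open>b2\<close>, and by \<open>c\<close> it equals \<beta> c + \<beta> \<kappa> r1 r2, where
    both summands are now known. Both give the same product, so S^2 = (M + m) S.\<close>
  define S where "S = \<beta> * s1 * s2"
  have P: "S\<^sup>2 = (M + c * m) * (m + c * M)" unfolding S_def using b1 b2 by algebra
  have "(M + m) * S = (M + c * m) * (m + c * M)" unfolding S_def using c \<beta> k by algebra
  then have "S * S = (M + m) * S" using P by (simp add: power2_eq_square)
  moreover have "S\<^sup>2 > 0" unfolding P using pos \<open>c \<ge> 0\<close> by (intro mult_pos_pos add_pos_nonneg) auto
  ultimately have "S = M + m" by auto
  then have "(c - 1) * (c * (M * m) + M\<^sup>2 + m\<^sup>2 + M * m) = 0" using P by algebra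
  moreover have "c * (M * m) + M\<^sup>2 + m\<^sup>2 + M * m > 0"
    using pos \<open>c \<ge> 0\<close> by (intro add_nonneg_pos add_nonneg_nonneg) auto
  ultimately show ?thesis by simp
qed

text \<open>Equal radii give equal heights, so c is a double-angle cosine in s1. Here k is the
  horizontal contribution of body 3, of opposite sign for the two opposed bodies; adding
  \<open>c13\<close> and \<open>c23\<close> removes it.\<close>

lemma equal_masses_solve:
  fixes m \<kappa> r1 r3 s1 s2 s3 c \<beta> k :: real
  assumes "m > 0" and "c \<ge> 0" "c \<noteq> 1"
    and s: "s1 \<ge> 0" "s2 \<ge> 0"
    and s1: "s1\<^sup>2 = 1 - \<kappa> * r1\<^sup>2" and s2: "s2\<^sup>2 = 1 - \<kappa> * r1\<^sup>2"
    and c12: "c = s1 * s2 - \<kappa> * r1 * r1"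
    and c13: "c = s1 * s3 + k" and c23: "c = s2 * s3 - k"
    and b1: "\<beta> * s1\<^sup>2 = m + c * m" and b3: "\<beta> * s3\<^sup>2 = (m + m) * c"
  shows "c = 0 \<and> s1 = s2 \<and> s3 = 0 \<and> \<kappa> * r1\<^sup>2 = 1 / 2 \<and> \<beta> = 2 * m"
proof -
  have eq: "s1 = s2" using s s1 s2 by (metis power2_eq_imp_eq)
  have c: "c = 2 * s1\<^sup>2 - 1" using c12 s1 unfolding eq by algebra
  then have "s1\<^sup>2 > 0" using \<open>c \<ge> 0\<close> by linarith
  have "s1\<^sup>2 * \<beta> = s1\<^sup>2 * (2 * m)" using b1 c by algebra
  then have \<beta>: "\<beta> = 2 * m" using \<open>s1\<^sup>2 > 0\<close> by simp
  have "2 * m * s3\<^sup>2 = 2 * m * c" using b3 unfolding \<beta> by simp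
  then have s3: "s3\<^sup>2 = c" using \<open>m > 0\<close> by simp
  have "c = s1 * s3" using c13 c23 unfolding eq by simp
  then have "c * (c - 1) = 0" using s3 c by algebra
  then have "c = 0" using \<open>c \<noteq> 1\<close> by simp
  then show ?thesis using eq s3 \<beta> c s1 by simp
qed

text \<open>With c = 0 the sides are quarter great circles, of chord
  \<open>sqrt (2 / \<kappa>)\<close> whatever the mass; the mass enters only through \<beta> = 2m,
  which fixes the angular speed.\<close>

lemma lagrangian_RE_solved:
  assumes "\<kappa> \<noteq> 0" and pos: "M > 0" "m > 0" and RE: "lagrangian_RE \<kappa> M m \<alpha> x y z"
  shows "\<kappa> > 0 \<and> M = m \<and> equal_mass_configuration \<kappa> x y z \<and>
    (\<forall>t. bdist \<kappa> x y z 1 2 t = sqrt (2 / \<kappa>)) \<and>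
    \<alpha>\<^sup>2 * force_denom \<kappa> (sqrt (2 / \<kappa>)) = 2 * m"
  using assms(1) RE
proof (rule lagrangian_RE_equations, goal_cases)
  case (1 \<theta> r1 r2 r3 s1 s2 s3 c d \<beta>)
  \<comment> \<open>The sign of c comes from the equation of body 3, whose left side is \<beta>
    times a square.\<close>
  have "(M + m) * c \<ge> 0" using 1(13,16) by (metis mult_nonneg_nonneg less_imp_le zero_le_power2)
  then have "c \<ge> 0" using pos by (simp add: zero_le_mult_iff)
  have "r1 * (\<beta> * s1\<^sup>2) = r1 * (M + c * m)" using 1(11,14) by algebra
  then have b1: "\<beta> * s1\<^sup>2 = M + c * m" using 1(1) by simp
  have "r2 * (\<beta> * s2\<^sup>2) = r2 * (m + c * M)" using 1(12,14) by algebra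
  then have b2: "\<beta> * s2\<^sup>2 = m + c * M" using 1(2) by simp
  have eq: "M = m"
    using unequal_masses_imp_collision[OF pos 1(1,2) \<open>c \<ge> 0\<close> _ 1(6-8) b1 b2 1(14)] 1(17) by blast
  then have r: "r2 = r1" using 1(14) pos by simp
  have *: "c = 0 \<and> s1 = s2 \<and> s3 = 0 \<and> \<kappa> * r1\<^sup>2 = 1 / 2 \<and> \<beta> = 2 * m"
    using equal_masses_solve[of m c s1 s2 \<kappa> r1 s3 "\<kappa> * r1 * r3 * cos \<theta>" \<beta>] 1 b1 pos \<open>c \<ge> 0\<close>
    unfolding eq r by blast
  \<comment> \<open>Positive curvature is forced by \<kappa> r1^2 = 1/2; this excludes the
    hyperbolic case.\<close>
  then have "\<kappa> > 0" using 1(1) zero_less_mult_pos2[of \<kappa> "r1\<^sup>2"] by simp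
  have "d \<ge> 0" using 1(18)[of 0] \<open>\<kappa> > 0\<close> by (auto simp: bdist_def)
  then have d: "d = sqrt (2 / \<kappa>)" using 1(19) * by (simp add: real_sqrt_unique)
  have "r1\<^sup>2 = 1 / (2 * \<kappa>)" using * \<open>\<kappa> > 0\<close> by (simp add: field_simps)
  then have "sqrt (1 / (2 * \<kappa>)) = r1" using 1(1) by (intro real_sqrt_unique) auto
  then have r1: "r1 = (2 * \<kappa>) powr (-1/2)"
    using \<open>\<kappa> > 0\<close> by (simp add: powr_minus_divide powr_half_sqrt real_sqrt_divide)
  have p: "\<kappa> powr - (1/2) = 1 / sqrt \<kappa>"
    using \<open>\<kappa> > 0\<close> by (simp add: powr_minus_divide powr_half_sqrt)
  have norm: "sqrt ((x 1 t)\<^sup>2 + (y 1 t)\<^sup>2) = r1" for t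
    using 1(1) 1(20)[of t] by (simp add: power_mult_distrib flip: distrib_left)
  \<comment> \<open>The equator is the level s = 0, whereas here s1^2 = 1/2.\<close>
  have "s1\<^sup>2 \<noteq> 0" using * 1(6) by simp
  then have "(s1 - 1) / sqrt \<kappa> \<noteq> - (1 / sqrt \<kappa>)" using \<open>\<kappa> > 0\<close> by (auto simp: field_simps)
  then have "equal_mass_configuration \<kappa> x y z"
    unfolding equal_mass_configuration_def norm
    using r1 1(20,21) * r \<open>\<kappa> > 0\<close> by (auto simp: p)
  then show ?case using \<open>\<kappa> > 0\<close> eq 1(15,18) * d by simp
qed

section \<open>Existence for equal masses\<close>

lemma lagrangian_RE_exists:
  assumes "\<kappa> > 0" and "m > 0"
  shows "\<exists>\<alpha> x y z. lagrangian_RE \<kappa> m m \<alpha> x y z"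
proof -
  define r where "r = 1 / sqrt (2 * \<kappa>)"
  define R where "R = 1 / sqrt \<kappa>"
  define d where "d = sqrt (2 / \<kappa>)"
  define D where "D = force_denom \<kappa> d"
  \<comment> \<open>Solves \<alpha>^2 D = 2m, the value of \<beta> forced above.\<close>
  define \<alpha> where "\<alpha> = sqrt (2 * m / D)"
  define a where "a = (\<lambda>i::nat. if i = 1 then r else if i = 2 then - r else 0)"
  define b where "b = (\<lambda>i::nat. if i = 3 then R else 0)"
  define s where "s = (\<lambda>i::nat. if i = 3 then 0 else sqrt (1/2))"
  define x where "x = (\<lambda>i t. a i * cos (\<alpha> * t) + (- b i) * sin (\<alpha> * t))"
  define y where "y = (\<lambda>i t. b i * cos (\<alpha> * t) + a i * sin (\<alpha> * t))"
  define z where "z = (\<lambda>i (t::real). (s i - 1) / sqrt \<bar>\<kappa>\<bar>)"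
  have r: "r > 0" "r\<^sup>2 = 1 / (2 * \<kappa>)" "\<kappa> * (r * r) = 1 / 2" and R: "R > 0" "R\<^sup>2 = 1 / \<kappa>"
    using \<open>\<kappa> > 0\<close> by (auto simp: r_def R_def power_divide)
  have sq: "1 - \<kappa> * ((a i)\<^sup>2 + (b i)\<^sup>2) = (s i)\<^sup>2" if "i \<in> {1, 2, 3}" for i
    using that r R \<open>\<kappa> > 0\<close> by (auto simp: a_def b_def s_def)
  interpret rotating_bodies \<kappa> \<alpha> x y z a b s
    using \<open>\<kappa> > 0\<close> sq by unfold_locales (auto simp: x_def y_def z_def s_def)
  \<comment> \<open>The three centred position vectors are mutually orthogonal.\<close>
  have "cosd i j = 0" if "i \<in> {1, 2, 3}" "j \<in> {1, 2, 3}" "i \<noteq> j" for i j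
    unfolding cosd_def using that r(3) by (auto simp: a_def b_def s_def)
  then have dist: "bdist \<kappa> x y z i j t = d" if "i \<in> {1, 2, 3}" "j \<in> {1, 2, 3}" "i \<noteq> j" for i j t
    using that bdist_eq by (auto simp: d_def)
  have d: "d > 0" "d\<^sup>2 = 2 / \<kappa>" "\<kappa> * d\<^sup>2 = 2" using \<open>\<kappa> > 0\<close> by (auto simp: d_def)
  have dists: "\<forall>j \<in> {1, 2, 3} - {i}. bdist \<kappa> x y z i j t = d" if "i \<in> {1, 2, 3}" for i t
    using that by (intro ballI dist) auto
  have cd: "1 - \<kappa> * d\<^sup>2 / 2 = 0" using d(3) by simp
  have D: "D > 0" using d by (simp add: D_def force_denom_def)
  have \<alpha>: "\<alpha> > 0" "\<alpha>\<^sup>2 = 2 * m / D" using D \<open>m > 0\<close> by (auto simp: \<alpha>_def)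
  have sets: "{Suc 0, 2, 3} - {Suc 0} = {2, 3}" "{Suc 0, 2, 3} - {2} = {Suc 0, 3}"
    "{Suc 0, 2, 3} - {3} = {Suc 0, 2}" by auto
  have p: "\<kappa> powr - (1/2) = R"
    using \<open>\<kappa> > 0\<close> by (simp add: R_def powr_minus_divide powr_half_sqrt)
  have sk: "sgn \<kappa> = 1" "\<bar>\<kappa>\<bar> = \<kappa>" "sqrt \<kappa> \<noteq> 0" "sqrt \<kappa> * sqrt \<kappa> = \<kappa>" using \<open>\<kappa> > 0\<close> by auto
  have hor: "horizontal_eq \<kappa> (restricted_masses m m) x y z u i t"
    if i: "i \<in> {1, 2, 3}" and u: "u = x \<or> u = y" for u i t
    unfolding horizontal_eq_iff[OF i u dists[OF i] cd]
    using i u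
    by (auto simp: sets restricted_masses_def D_def[symmetric] \<alpha>(2) x_def y_def a_def b_def s_def
        algebra_simps power_divide)
  have ver: "vertical_eq \<kappa> (restricted_masses m m) x y z i t" if "i \<in> {1, 2}" for i t
  proof -
    have i: "i \<in> {1, 2, 3}" using that by auto
    show ?thesis
      unfolding vertical_eq_iff[OF i dists[OF i] cd]
      using that
      by (auto simp: sets restricted_masses_def D_def[symmetric] \<alpha>(2) s_def power_divide)
  qed
  \<comment> \<open>Body 3 is on the equator, where \<open>curved_solution\<close> imposes no
    vertical equation; hence \<open>ver\<close> covers bodies 1 and 2.\<close>
  have z3: "\<kappa> * z 3 t + sgn \<kappa> * sqrt \<bar>\<kappa>\<bar> = 0" for t
    using sk by (simp add: z_def s_def field_simps)
  have surf: "on_surface \<kappa> (x i t) (y i t) (z i t)" if i: "i \<in> {1, 2, 3}" for i t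
  proof -
    have zq: "sqrt \<kappa> * z i t = s i - 1" using sk by (simp add: z_def)
    have "\<kappa> * ((x i t)\<^sup>2 + (y i t)\<^sup>2 + (z i t)\<^sup>2) + 2 * sqrt \<kappa> * z i t = 0"
      using zq sk(4) norm_xy[OF i, of t] sq[OF i] by algebra
    moreover have "z i t \<ge> - R"
      using s_nonneg[OF i] \<open>\<kappa> > 0\<close> by (simp add: z_def R_def field_simps)
    ultimately show ?thesis
      using \<open>\<kappa> > 0\<close> by (simp add: on_surface_def p)
  qed
  have "twice_differentiable (x i)" "twice_differentiable (y i)" "twice_differentiable (z i)" for i
  proof -
    show "twice_differentiable (x i)" unfolding x_def by (rule twice_differentiable_trig)
    show "twice_differentiable (y i)" unfolding y_def by (rule twice_differentiable_trig)
    show "twice_differentiable (z i)" unfolding z_def twice_differentiable_def by simp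
  qed
  then have "admissible_motion \<kappa> x y z"
    unfolding admissible_motion_def using surf dist d by simp
  then have sol: "curved_solution \<kappa> (restricted_masses m m) x y z"
    unfolding curved_solution_def using hor ver z3 by blast
  have height: "z i t = - sgn \<kappa> * sqrt \<bar>\<kappa>\<bar> * ((x i t)\<^sup>2 + (y i t)\<^sup>2)
      / (1 + sqrt (1 - \<kappa> * ((x i t)\<^sup>2 + (y i t)\<^sup>2)))" if i: "i \<in> {1, 2, 3}" for i t
  proof -
    have *: "1 - \<kappa> * ((x i t)\<^sup>2 + (y i t)\<^sup>2) = (s i)\<^sup>2" using norm_xy[OF i] sq[OF i] by simp
    then have "\<kappa> * ((x i t)\<^sup>2 + (y i t)\<^sup>2) \<le> 1" by (metis diff_ge_0_iff_ge zero_le_power2)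
    with \<open>\<kappa> > 0\<close> show ?thesis
      using height_eq[of \<kappa> "(x i t)\<^sup>2 + (y i t)\<^sup>2"] * s_nonneg[OF i] by (simp add: z_def)
  qed
  have "r \<le> R" using \<open>\<kappa> > 0\<close> by (auto simp: r_def R_def intro!: divide_left_mono)
  \<comment> \<open>The angle is pi/2 because body 3 starts at (0, R), a quarter turn from body
    1.\<close>
  then have "lagrangian_motion \<kappa> \<alpha> x y z"
    unfolding lagrangian_motion_def
    using r R height dist \<alpha>(1)
    by (intro conjI exI[of _ "pi/2"] exI[of _ r] exI[of _ R])
      (auto simp: p x_def y_def a_def b_def cos_add sin_add)
  then show ?thesis using sol unfolding lagrangian_RE_def by blast
qed

section \<open>Nonexistence, the equal-mass family, and its dependence on the mass\<close>

theorem theorem8: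
  fixes M m :: real
  assumes "M > 0" and "m > 0"
  shows "(\<forall>\<kappa><0. \<nexists>\<alpha> x y z. lagrangian_RE \<kappa> M m \<alpha> x y z)
    \<and> (\<exists>\<kappa>0>0. \<forall>\<kappa>. 0 < \<kappa> \<and> \<kappa> < \<kappa>0 \<longrightarrow>
         (M \<noteq> m \<longrightarrow> (\<nexists>\<alpha> x y z. lagrangian_RE \<kappa> M m \<alpha> x y z)) \<and>
         (M = m \<longrightarrow>
            (\<exists>\<alpha> x y z. lagrangian_RE \<kappa> M m \<alpha> x y z) \<and>
            (\<forall>\<alpha> x y z. lagrangian_RE \<kappa> M m \<alpha> x y z \<longrightarrow> equal_mass_configuration \<kappa> x y z)))
    \<and> (\<forall>m'>0. \<exists>\<kappa>0>0. \<forall>\<kappa>. 0 < \<kappa> \<and> \<kappa> < \<kappa>0 \<longrightarrow>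
         (\<forall>\<alpha> x y z \<alpha>' x' y' z'.
            lagrangian_RE \<kappa> m m \<alpha> x y z \<and> lagrangian_RE \<kappa> m' m' \<alpha>' x' y' z' \<longrightarrow>
            (\<forall>t t'. bdist \<kappa> x y z 1 2 t = bdist \<kappa> x' y' z' 1 2 t') \<and>
            (m \<noteq> m' \<longrightarrow> \<bar>\<alpha>\<bar> \<noteq> \<bar>\<alpha>'\<bar>)))"
proof (intro conjI allI impI)
  show "\<nexists>\<alpha> x y z. lagrangian_RE \<kappa> M m \<alpha> x y z" if "\<kappa> < 0" for \<kappa>
    using lagrangian_RE_solved[of \<kappa>] assms that by force
next
  have "(M \<noteq> m \<longrightarrow> (\<nexists>\<alpha> x y z. lagrangian_RE \<kappa> M m \<alpha> x y z)) \<and>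
         (M = m \<longrightarrow>
            (\<exists>\<alpha> x y z. lagrangian_RE \<kappa> M m \<alpha> x y z) \<and>
            (\<forall>\<alpha> x y z. lagrangian_RE \<kappa> M m \<alpha> x y z \<longrightarrow> equal_mass_configuration \<kappa> x y z))"
    if "\<kappa> > 0" for \<kappa>
    using lagrangian_RE_solved[of \<kappa> M m] lagrangian_RE_exists[of \<kappa> m] assms that by blast
  then show "\<exists>\<kappa>0>0. \<forall>\<kappa>. 0 < \<kappa> \<and> \<kappa> < \<kappa>0 \<longrightarrow>
         (M \<noteq> m \<longrightarrow> (\<nexists>\<alpha> x y z. lagrangian_RE \<kappa> M m \<alpha> x y z)) \<and>
         (M = m \<longrightarrow>
            (\<exists>\<alpha> x y z. lagrangian_RE \<kappa> M m \<alpha> x y z) \<and>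
            (\<forall>\<alpha> x y z. lagrangian_RE \<kappa> M m \<alpha> x y z \<longrightarrow> equal_mass_configuration \<kappa> x y z))"
    \<comment> \<open>The fact was shown at every positive curvature, so the witness 1 is an
      arbitrary choice; likewise in the last claim.\<close>
    by (intro exI[of _ 1]) simp
next
  fix m' :: real assume "m' > 0"
  have "(\<forall>t t'. bdist \<kappa> x y z 1 2 t = bdist \<kappa> x' y' z' 1 2 t') \<and> (m \<noteq> m' \<longrightarrow> \<bar>\<alpha>\<bar> \<noteq> \<bar>\<alpha>'\<bar>)"
    if "\<kappa> > 0" "lagrangian_RE \<kappa> m m \<alpha> x y z \<and> lagrangian_RE \<kappa> m' m' \<alpha>' x' y' z'"
    for \<kappa> \<alpha> x y z \<alpha>' x' y' z'
  proof -
    have A: "\<forall>t. bdist \<kappa> x y z 1 2 t = sqrt (2 / \<kappa>)"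
        "\<alpha>\<^sup>2 * force_denom \<kappa> (sqrt (2 / \<kappa>)) = 2 * m"
      using lagrangian_RE_solved[of \<kappa> m m \<alpha> x y z] that \<open>m > 0\<close> by auto
    have B: "\<forall>t. bdist \<kappa> x' y' z' 1 2 t = sqrt (2 / \<kappa>)"
        "\<alpha>'\<^sup>2 * force_denom \<kappa> (sqrt (2 / \<kappa>)) = 2 * m'"
      using lagrangian_RE_solved[of \<kappa> m' m' \<alpha>' x' y' z'] that \<open>m' > 0\<close> by auto
    \<comment> \<open>Both triangles have the same side, hence the same force denominator, so equal
      angular speeds force equal masses.\<close>
    have "m = m'" if "\<bar>\<alpha>\<bar> = \<bar>\<alpha>'\<bar>"
    proof -
      have "\<alpha>\<^sup>2 = \<alpha>'\<^sup>2" using that by (simp add: abs_eq_iff power2_eq_iff)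
      then show ?thesis using A(2) B(2) by simp
    qed
    then show ?thesis using A(1) B(1) by auto
  qed
  then show "\<exists>\<kappa>0>0. \<forall>\<kappa>. 0 < \<kappa> \<and> \<kappa> < \<kappa>0 \<longrightarrow>
         (\<forall>\<alpha> x y z \<alpha>' x' y' z'.
            lagrangian_RE \<kappa> m m \<alpha> x y z \<and> lagrangian_RE \<kappa> m' m' \<alpha>' x' y' z' \<longrightarrow>
            (\<forall>t t'. bdist \<kappa> x y z 1 2 t = bdist \<kappa> x' y' z' 1 2 t') \<and>
            (m \<noteq> m' \<longrightarrow> \<bar>\<alpha>\<bar> \<noteq> \<bar>\<alpha>'\<bar>))"
    by (intro exI[of _ 1]) auto
qed

end
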